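(* For every non-negative integer $n$, $$\sum_{\substack{j_0+j_1+\dots+j_{2n}=2 \\ j_0, j_1, \dots, j_{2n} \geq 0}} \zeta^*(\{2\}^{j_0}, 3, \{2\}^{j_1}, 1, \{2\}^{j_2}, 3, \dots, 3, \{2\}^{j_{2n-1}}, 1, \{2\}^{j_{2n}}) \in \mathbb{Q} \cdot \pi^{4n+4}.$$
   Context: For positive integers $k_1,\dots,k_r$ with $k_1\ge 2$, the multiple zeta-star value is $\zeta^*(k_1,\dots,k_r)=\sum_{m_1\ge m_2\ge\dots\ge m_r\ge 1} m_1^{-k_1}m_2^{-k_2}\cdots m_r^{-k_r}$. The notation $\{2\}^j$ denotes the string $2,2,\dots,2$ of length $j$ (empty if $j=0$). The index in the sum is obtained from the string $3,1,3,1,\dots,3,1$ (with $n$ copies of $3,1$) by inserting $\{2\}^{j_0}$ before the first entry, $\{2\}^{j_i}$ between the $i$-th and $(i+1)$-st entries for $1\le i\le 2n-1$, and $\{2\}^{j_{2n}}$ after the last entry. For $n=0$ the sum is just $\zeta^*(2,2)$. *)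

theory Defs
  imports "HOL-Analysis.Analysis"
begin

text \<open>
  The summation range consists of all weakly decreasing lists of positive integers of the same
  length as the index. All summands are nonnegative, so the unordered sum \<^const>\<open>infsum\<close> is the
  classical value whenever the series converges, which is the case if the first entry of the index
  is at least 2 and all other entries are positive.
\<close>

definition zeta_star :: "nat list \<Rightarrow> real" where
  "zeta_star ks =
     (\<Sum>\<^sub>\<infinity>ms\<in>{ms :: nat list. length ms = length ks \<and> sorted_wrt (\<ge>) ms \<and> (\<forall>m\<in>set ms. m \<ge> 1)}.
        \<Prod>i<length ks. 1 / real (ms ! i) ^ (ks ! i))"

text \<open>
  For \<open>js = [j\<^sub>0, \<dots>, j\<^sub>2\<^sub>n]\<close> the index is
  \<open>{2}^j\<^sub>0, 3, {2}^j\<^sub>1, 1, {2}^j\<^sub>2, \<dots>, 3, {2}^j\<^sub>2\<^sub>n\<^sub>-\<^sub>1, 1, {2}^j\<^sub>2\<^sub>n\<close>: with positions counted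
  from 0, block \<open>i < 2 * n\<close> of twos is followed by 3 if \<open>i\<close> is even and by 1 if \<open>i\<close> is odd.
\<close>

definition inserted_index :: "nat \<Rightarrow> nat list \<Rightarrow> nat list" where
  "inserted_index n js =
     concat (map (\<lambda>i. replicate (js ! i) 2 @ [if even i then 3 else 1]) [0..<2 * n])
     @ replicate (js ! (2 * n)) 2"

end

theory Submission
  imports Defs
begin

text \<open>
  Let \<open>d = 1/m\<close>. Reading a word in the letters 2, 3, 1 (3 and 1 alternating) from its largest
  summation variable downwards turns the generating series of the truncated zeta-star sums, in
  which \<open>s\<close> counts letters and each 2 has an extra weight \<open>y\<close>, into an entry of the product
  of the matrices \<open>(I - s N(y))\<^sup>-\<^sup>1\<close>, where \<open>N(y)\<close> has rows \<open>(y d\<^sup>2, d\<^sup>3)\<close> and \<open>(d, y d\<^sup>2)\<close>.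
  Since \<open>(I - s N(y))\<^sup>-\<^sup>1 = (I + s N(-y)) / det\<close> with
  \<open>det = (1 - (y + 1) s d\<^sup>2) (1 - (y - 1) s d\<^sup>2)\<close>, this is the non-star generating series at \<open>-y\<close>
  divided by two products of sine type.

  For the non-star series put \<open>-y = a + b\<close> with \<open>4 a b = 1\<close>. As in the theorem of Bowman and
  Bradley, its polylogarithmic version is the product of the two hypergeometric series
  \<open>F(u, -u; 1; t)\<close> with \<open>u\<^sup>2 = -a s\<close> and \<open>u\<^sup>2 = -b s\<close>, because both satisfy the same
  differential system. At \<open>t = 1\<close> one obtains two more sine products. Hence the coefficient of
  \<open>s\<^sup>N\<close> is a rational multiple of \<open>\<pi>\<^sup>2\<^sup>N\<close> whenever \<open>a\<close> and \<open>b\<close> are rational. It is a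
  polynomial in \<open>y\<close>, and infinitely many rational values of \<open>y\<close> arise in this way, so each of
  its coefficients is a rational multiple of \<open>\<pi>\<^sup>2\<^sup>N\<close>; the theorem is the coefficient of \<open>y\<^sup>2\<close>
  for \<open>N = 2n + 2\<close>.
\<close>

section \<open>Truncated multiple zeta-star values\<close>

definition star_range :: "nat \<Rightarrow> nat \<Rightarrow> nat list set" where
  "star_range M l = {ms. length ms = l \<and> sorted_wrt (\<ge>) ms \<and> set ms \<subseteq> {1..M}}"

definition star_weight :: "nat list \<Rightarrow> nat list \<Rightarrow> real" where
  "star_weight ks ms = (\<Prod>i<length ks. 1 / real (ms ! i) ^ (ks ! i))"

definition zeta_star_upto :: "nat \<Rightarrow> nat list \<Rightarrow> real" where
  "zeta_star_upto M ks = sum (star_weight ks) (star_range M (length ks))"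

lemma star_weight_nonneg [simp]: "star_weight ks ms \<ge> 0"
  by (auto simp: star_weight_def intro!: prod_nonneg)

lemma star_weight_Cons: "star_weight (k # ks) (m # ms) = 1 / real m ^ k * star_weight ks ms"
  by (simp add: star_weight_def prod.lessThan_Suc_shift del: prod.lessThan_Suc)

lemma finite_star_range [simp]: "finite (star_range M l)"
  by (rule finite_subset[OF _ finite_lists_length_eq[of "{1..M}" l]]) (auto simp: star_range_def)

lemma star_range_0_left [simp]: "star_range 0 (Suc l) = {}"
  by (auto simp: star_range_def)

lemma star_range_0_right [simp]: "star_range M 0 = {[]}"
  by (auto simp: star_range_def)

lemma star_range_mono: "M \<le> N \<Longrightarrow> star_range M l \<subseteq> star_range N l"
  by (auto simp: star_range_def)

text \<open>The head is either at most \<open>M\<close> or equal to \<open>Suc M\<close>. As the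
  order is weak, the tail may then use \<open>Suc M\<close> again, which makes all later recursions
  implicit in the value at \<open>Suc M\<close>.\<close>

lemma star_range_Suc:
  "star_range (Suc M) (Suc l) = star_range M (Suc l) \<union> (#) (Suc M) ` star_range (Suc M) l"
proof (intro equalityI subsetI)
  fix ms assume "ms \<in> star_range (Suc M) (Suc l)"
  then obtain m ms' where ms: "ms = m # ms'" "length ms' = l" "sorted_wrt (\<ge>) ms'" "\<forall>x\<in>set ms'. x \<le> m"
      "m \<in> {1..Suc M}" "set ms' \<subseteq> {1..Suc M}"
    by (cases ms) (auto simp: star_range_def)
  then show "ms \<in> star_range M (Suc l) \<union> (#) (Suc M) ` star_range (Suc M) l"
  proof (cases "m = Suc M")
    case True
    then show ?thesis using ms by (auto simp: star_range_def)
  next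
    case False
    then have "m \<le> M" "set ms' \<subseteq> {1..M}" using ms by force+
    then show ?thesis using ms by (auto simp: star_range_def)
  qed
next
  fix ms assume "ms \<in> star_range M (Suc l) \<union> (#) (Suc M) ` star_range (Suc M) l"
  then show "ms \<in> star_range (Suc M) (Suc l)"
    using star_range_mono[of M "Suc M" "Suc l"] by (force simp: star_range_def)
qed

lemma zeta_star_upto_Nil [simp]: "zeta_star_upto M [] = 1"
  by (simp add: zeta_star_upto_def star_weight_def)

lemma zeta_star_upto_0 [simp]: "zeta_star_upto 0 (k # ks) = 0"
  by (simp add: zeta_star_upto_def)

lemma zeta_star_upto_Suc:
  "zeta_star_upto (Suc M) (k # ks) =
     zeta_star_upto M (k # ks) + zeta_star_upto (Suc M) ks / real (Suc M) ^ k"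
proof -
  have "star_range M (Suc (length ks)) \<inter> (#) (Suc M) ` star_range (Suc M) (length ks) = {}"
    by (auto simp: star_range_def)
  then have "zeta_star_upto (Suc M) (k # ks) = zeta_star_upto M (k # ks) +
      sum (star_weight (k # ks)) ((#) (Suc M) ` star_range (Suc M) (length ks))"
    by (simp add: zeta_star_upto_def star_range_Suc sum.union_disjoint)
  also have "sum (star_weight (k # ks)) ((#) (Suc M) ` star_range (Suc M) (length ks)) =
      zeta_star_upto (Suc M) ks / real (Suc M) ^ k"
    by (simp add: zeta_star_upto_def sum.reindex star_weight_Cons sum_divide_distrib del: of_nat_Suc)
  finally show ?thesis .
qed

lemma zeta_star_upto_nonneg [simp]: "zeta_star_upto M ks \<ge> 0"
  by (simp add: zeta_star_upto_def sum_nonneg)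

lemma zeta_star_upto_mono: "M \<le> N \<Longrightarrow> zeta_star_upto M ks \<le> zeta_star_upto N ks"
  unfolding zeta_star_upto_def by (rule sum_mono2) (auto simp: star_range_mono)

text \<open>Every finite set of admissible lists lies in some \<open>star_range\<close>, so a bound
  on the truncations bounds all finite partial sums and gives summability. The bound itself comes
  later, from the generating series.\<close>

lemma zeta_star_upto_tendsto:
  assumes bound: "\<And>M. zeta_star_upto M ks \<le> C"
  shows "(\<lambda>M. zeta_star_upto M ks) \<longlonglongrightarrow> zeta_star ks"
proof -
  define S where "S = {ms :: nat list. length ms = length ks \<and> sorted_wrt (\<ge>) ms \<and> (\<forall>m\<in>set ms. m \<ge> 1)}"
  have inc: "incseq (\<lambda>M. zeta_star_upto M ks)"
    by (simp add: incseq_def zeta_star_upto_mono)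
  then obtain L where L: "(\<lambda>M. zeta_star_upto M ks) \<longlonglongrightarrow> L" "\<And>M. zeta_star_upto M ks \<le> L"
    using incseq_convergent[OF inc, of C] bound by blast
  have fin: "sum (star_weight ks) F \<le> L" if "finite F" "F \<subseteq> S" for F
  proof -
    \<comment> \<open>If \<open>F\<close> contains no nonempty list, \<open>Max\<close> is taken of
      the empty set; the inclusion then holds whatever its value.\<close>
    have "finite (\<Union>(set ` F))" using that by auto
    then have "\<forall>ms\<in>F. set ms \<subseteq> {..Max (\<Union>(set ` F))}" by (auto intro!: Max_ge)
    then have "F \<subseteq> star_range (Max (\<Union>(set ` F))) (length ks)"
      using that(2) by (auto simp: star_range_def S_def subset_iff)
    then have "sum (star_weight ks) F \<le> zeta_star_upto (Max (\<Union>(set ` F))) ks"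
      unfolding zeta_star_upto_def by (rule sum_mono2[rotated]) auto
    with L(2) show ?thesis by (rule order_trans[rotated])
  qed
  have summ: "star_weight ks summable_on S"
    by (rule nonneg_bdd_above_summable_on) (auto intro!: bdd_aboveI2 fin)
  have zs: "zeta_star ks = infsum (star_weight ks) S"
    unfolding zeta_star_def S_def star_weight_def by simp
  have "infsum (star_weight ks) S \<le> L"
    using summ fin by (rule infsum_le_finite_sums)
  moreover have "zeta_star_upto M ks \<le> infsum (star_weight ks) S" for M
    unfolding zeta_star_upto_def using summ
    by (rule finite_sum_le_infsum[OF _ finite_star_range]) (auto simp: star_range_def S_def)
  then have "L \<le> infsum (star_weight ks) S"
    using L(1) by (intro LIMSEQ_le_const2) auto
  ultimately show ?thesis using L(1) zs by simp
qed

text \<open>One letter is produced at a time, starting with the exponent of the largest variable.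
  The choice between 3 and 1 depends on how many odd letters remain, so every tail of a word has the
  same form; tails with an odd number of odd letters have 1 as their first odd letter.\<close>

function insert_twos :: "nat list \<Rightarrow> nat list" where
  "insert_twos [] = []"
| "insert_twos (Suc j # js) = 2 # insert_twos (j # js)"
| "insert_twos (0 # js) = (if js = [] then [] else (if even (length js) then 3 else 1) # insert_twos js)"
  by pat_completeness auto
termination by (relation "Wellfounded.measure (\<lambda>js. sum_list js + length js)") auto

lemma insert_twos_Cons: "insert_twos (j # js) = replicate j 2 @ insert_twos (0 # js)"
  by (induction j) auto

lemma insert_twos_eq_concat:
  assumes "length js = Suc r"
  shows "insert_twos js = concat (map (\<lambda>i. replicate (js ! i) 2 @ [if even (r + i) then 3 else 1]) [0..<r])
     @ replicate (js ! r) 2"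
  using assms
proof (induction r arbitrary: js)
  case 0
  then obtain j where "js = [j]" by (auto simp: length_Suc_conv)
  then show ?case by (simp add: insert_twos_Cons[of j "[]"])
next
  case (Suc r)
  then obtain j js' where js: "js = j # js'" "length js' = Suc r" by (auto simp: length_Suc_conv)
  have "[0..<Suc r] = 0 # map Suc [0..<r]" by (simp only: map_Suc_upt upt_conv_Cons[of 0] zero_less_Suc)
  then show ?case using Suc.IH[OF js(2)] js
    by (auto simp: insert_twos_Cons[of j js'] comp_def simp del: upt_Suc)
qed

lemma inserted_index_eq:
  assumes "length js = 2 * n + 1"
  shows "inserted_index n js = insert_twos js"
  using insert_twos_eq_concat[of js "2 * n"] assms by (simp add: inserted_index_def)

section \<open>Sums over all words with \<open>r\<close> odd letters and \<open>j\<close>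
  twos\<close>

definition compositions :: "nat \<Rightarrow> nat \<Rightarrow> nat list set" where
  "compositions r j = {js. length js = r + 1 \<and> sum_list js = j}"

lemma finite_compositions [simp]: "finite (compositions r j)"
  by (rule finite_subset[OF _ finite_lists_length_eq[of "{..j}" "r + 1"]])
     (auto simp: compositions_def member_le_sum_list)

text \<open>Case distinction on the first letter: none, a 2 (\<open>hd js > 0\<close>), or an odd
  letter (\<open>hd js = 0\<close>), whose value is fixed by the parity of \<open>r\<close>.\<close>

lemma sum_compositions:
  fixes f :: "nat list \<Rightarrow> real"
  shows "(\<Sum>js\<in>compositions r j. f (insert_twos js)) =
    (if r = 0 \<and> j = 0 then f [] else 0)
    + (if j = 0 then 0 else \<Sum>js\<in>compositions r (j - 1). f (2 # insert_twos js))
    + (if r = 0 then 0 else \<Sum>js\<in>compositions (r - 1) j. f ((if even r then 3 else 1) # insert_twos js))"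
proof -
  let ?A = "{js \<in> compositions r j. hd js > 0}" and ?B = "{js \<in> compositions r j. hd js = 0}"
  have "(\<Sum>js\<in>compositions r j. f (insert_twos js)) = (\<Sum>js\<in>?A. f (insert_twos js)) + (\<Sum>js\<in>?B. f (insert_twos js))"
  proof -
    have "compositions r j = ?A \<union> ?B" by auto
    then have "(\<Sum>js\<in>compositions r j. f (insert_twos js)) = (\<Sum>js\<in>?A \<union> ?B. f (insert_twos js))"
      by (rule arg_cong)
    also have "\<dots> = (\<Sum>js\<in>?A. f (insert_twos js)) + (\<Sum>js\<in>?B. f (insert_twos js))"
      by (rule sum.union_disjoint) auto
    finally show ?thesis .
  qed
  moreover have "(\<Sum>js\<in>?A. f (insert_twos js)) = (if j = 0 then 0 else \<Sum>js\<in>compositions r (j - 1). f (2 # insert_twos js))"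
  proof (cases j)
    case 0
    then have "?A = {}" by (auto simp: compositions_def length_Suc_conv)
    then show ?thesis using 0 by (simp only: sum.empty if_True refl)
  next
    case (Suc i)
    have "(\<Sum>js\<in>compositions r i. f (2 # insert_twos js)) = (\<Sum>js\<in>?A. f (insert_twos js))"
      by (rule sum.reindex_bij_witness[where i = "\<lambda>js. (hd js - 1) # tl js" and j = "\<lambda>js. Suc (hd js) # tl js"])
         (auto simp: compositions_def length_Suc_conv Suc gr0_conv_Suc)
    then show ?thesis using Suc by simp
  qed
  moreover have "(\<Sum>js\<in>?B. f (insert_twos js)) = (if r = 0 \<and> j = 0 then f [] else 0) +
     (if r = 0 then 0 else \<Sum>js\<in>compositions (r - 1) j. f ((if even r then 3 else 1) # insert_twos js))"
  proof (cases r)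
    case 0
    then have "?B = (if j = 0 then {[0]} else {})" by (auto simp: compositions_def length_Suc_conv)
    then show ?thesis using 0 by simp
  next
    case (Suc q)
    have "(\<Sum>js\<in>compositions q j. f ((if even r then 3 else 1) # insert_twos js)) = (\<Sum>js\<in>?B. f (insert_twos js))"
      by (rule sum.reindex_bij_witness[where i = tl and j = "(#) 0"])
         (auto simp: compositions_def length_Suc_conv Suc)
    then show ?thesis using Suc by simp
  qed
  ultimately show ?thesis by linarith
qed

definition star_sum :: "nat \<Rightarrow> nat \<Rightarrow> nat \<Rightarrow> real" where
  "star_sum r j M = (\<Sum>js\<in>compositions r j. zeta_star_upto M (insert_twos js))"

lemma star_sum_0: "star_sum r j 0 = (if r = 0 \<and> j = 0 then 1 else 0)"
  unfolding star_sum_def sum_compositions[of "zeta_star_upto 0" r j] by simp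

text \<open>Either the largest variable is at most \<open>M\<close>, or it equals
  \<open>Suc M\<close> and the first letter is split off.\<close>

lemma star_sum_Suc:
  "star_sum r j (Suc M) = star_sum r j M
     + (if j = 0 then 0 else star_sum r (j - 1) (Suc M) / real (Suc M) ^ 2)
     + (if r = 0 then 0 else star_sum (r - 1) j (Suc M) / real (Suc M) ^ (if even r then 3 else 1))"
  unfolding star_sum_def
    sum_compositions[of "zeta_star_upto (Suc M)" r j] sum_compositions[of "zeta_star_upto M" r j]
  by (cases "j = 0"; cases "r = 0")
     (simp_all add: zeta_star_upto_Suc sum.distrib sum_divide_distrib del: of_nat_Suc)

section \<open>The product of two hypergeometric series\<close>

text \<open>The Euler operator t d/dt, a derivation acting diagonally on coefficients.\<close>

definition fps_theta :: "'a::comm_ring_1 fps \<Rightarrow> 'a fps" where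
  "fps_theta f = fps_X * fps_deriv f"

lemma fps_theta_nth [simp]: "fps_nth (fps_theta f) n = of_nat n * fps_nth f n"
  by (cases n) (simp_all add: fps_theta_def)

lemma fps_theta_add: "fps_theta (f + g) = fps_theta f + fps_theta g"
  by (simp add: fps_theta_def algebra_simps)

lemma fps_theta_mult: "fps_theta (f * g) = fps_theta f * g + f * fps_theta g"
  by (simp add: fps_theta_def algebra_simps)

lemma fps_theta_const [simp]: "fps_theta (fps_const c) = 0"
  by (simp add: fps_theta_def)

text \<open>Division by 1 - t sums coefficients. This turns differential equations into recursions
  for truncated sums.\<close>

lemma fps_nth_eq_partial_sum:
  fixes U V :: "'a::comm_ring_1 fps"
  assumes "(1 - fps_X) * U = fps_X * V"
  shows "fps_nth U (Suc n) = (\<Sum>i\<le>n. fps_nth V i)"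
proof -
  have eq: "fps_nth U k - (if k = 0 then 0 else fps_nth U (k - 1)) = 
        (if k = 0 then 0 else fps_nth V (k - 1))" for k
    using arg_cong[OF assms, of "\<lambda>f. fps_nth f k"] by (simp add: left_diff_distrib)
  show ?thesis
  proof (induction n)
    case 0
    show ?case using eq[of 0] eq[of 1] by simp
  next
    case (Suc n)
    then show ?case using eq[of "Suc (Suc n)"] by (simp add: algebra_simps)
  qed
qed

text \<open>The coefficients of \<open>F(u, -u; 1; t)\<close> for \<open>u\<^sup>2 = -a s\<close>, where \<open>s\<close> is \<^term>\<open>fps_X\<close>.\<close>

fun hyper_coeff :: "real \<Rightarrow> nat \<Rightarrow> real fps" where
  "hyper_coeff a 0 = 1"
| "hyper_coeff a (Suc k) = fps_const (1 / real (Suc k) ^ 2) *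
     (fps_const (real k ^ 2) + fps_const a * fps_X) * hyper_coeff a k"

text \<open>A series in t over series in s; \<open>fps_X\<close> is t on the outer level and s on
  the inner one.\<close>

abbreviation hyper_fps :: "real \<Rightarrow> real fps fps" where
  "hyper_fps a \<equiv> Abs_fps (hyper_coeff a)"

lemma hyper_coeff_rec:
  "of_nat (Suc k) * (of_nat (Suc k) * hyper_coeff a (Suc k)) =
     of_nat k * (of_nat k * hyper_coeff a k) + fps_const a * fps_X * hyper_coeff a k"
proof -
  have 1: "of_nat (Suc k) * of_nat (Suc k) * fps_const (1 / real (Suc k) ^ 2) = (1 :: real fps)"
    by (simp flip: fps_of_nat fps_const_1_eq_1 add: power2_eq_square del: of_nat_Suc)
  have "of_nat (Suc k) * (of_nat (Suc k) * hyper_coeff a (Suc k)) =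
     (of_nat (Suc k) * of_nat (Suc k) * fps_const (1 / real (Suc k) ^ 2)) *
     ((fps_const (real k ^ 2) + fps_const a * fps_X) * hyper_coeff a k)"
    by (simp only: hyper_coeff.simps mult.assoc)
  also have "\<dots> = (fps_const (real k ^ 2) + fps_const a * fps_X) * hyper_coeff a k"
    unfolding 1 by simp
  also have "fps_const (real k ^ 2) = of_nat k * of_nat k"
    by (simp flip: fps_of_nat add: power2_eq_square)
  finally show ?thesis by (simp add: algebra_simps)
qed

text \<open>The hypergeometric equation for parameters u, -u; 1 in Euler form, obtained by comparing
  coefficients of t.\<close>

lemma hyper_fps_ode:
  "(1 - fps_X) * fps_theta (fps_theta (hyper_fps a)) =
     fps_X * fps_const (fps_const a * fps_X) * hyper_fps a"
proof (rule fps_ext)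
  fix n
  show "fps_nth ((1 - fps_X) * fps_theta (fps_theta (hyper_fps a))) n =
     fps_nth (fps_X * fps_const (fps_const a * fps_X) * hyper_fps a) n"
  proof (cases n)
    case 0
    then show ?thesis by (simp add: left_diff_distrib)
  next
    case (Suc k)
    then show ?thesis
      using hyper_coeff_rec[of k a]
      by (simp add: left_diff_distrib mult.assoc del: hyper_coeff.simps of_nat_Suc)
  qed
qed

definition hyper_prod :: "real \<Rightarrow> real \<Rightarrow> real fps fps" where
  "hyper_prod a b = hyper_fps a * hyper_fps b"

text \<open>
  The companion of the product series in the differential system; it plays the role of the words
  whose first odd letter is 1.
\<close>

definition hyper_conj :: "real \<Rightarrow> real \<Rightarrow> real fps fps" where
  "hyper_conj a b = 2 * (fps_const (fps_const a) * hyper_fps a * fps_theta (hyper_fps b) +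
     fps_const (fps_const b) * fps_theta (hyper_fps a) * hyper_fps b)"

text \<open>This is one application of the matrix I + s N(z). Besides the product and its companion,
  the auxiliary series \<open>E = G1 * H1\<close> enters; three differential relations become
  coefficient identities \<open>1\<close>, \<open>2\<close>, \<open>3\<close>, from which the
  coefficient of \<open>E\<close> is eliminated.\<close>

lemma hyper_prod_rec:
  fixes a b :: real and m :: nat
  assumes ab: "4 * a * b = 1"
  defines "P \<equiv> \<lambda>m. \<Sum>i\<le>m. fps_nth (hyper_prod a b) i"
    and "Q \<equiv> \<lambda>m. \<Sum>i\<le>m. fps_nth (hyper_conj a b) i"
    and "d \<equiv> fps_const (1 / real (Suc m))" and "z \<equiv> fps_const (a + b)"
  shows "P (Suc m) = (1 + z * fps_X * d ^ 2) * P m + fps_X * d ^ 3 * Q m"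
    and "Q (Suc m) = (1 + z * fps_X * d ^ 2) * Q m + fps_X * d * P m"
proof -
  define A B S :: "real fps fps" where "A = fps_const (fps_const a)"
    and "B = fps_const (fps_const b)" and "S = fps_const fps_X"
  define G H where "G = hyper_fps a" and "H = hyper_fps b"
  define G1 H1 where "G1 = fps_theta G" and "H1 = fps_theta H"
  define G2 H2 where "G2 = fps_theta G1" and "H2 = fps_theta H1"
  define E where "E = G1 * H1"
  have const: "fps_const (fps_const x * fps_X) = fps_const (fps_const x) * S" for x
    by (simp add: S_def)
  have G: "(1 - fps_X) * G2 = fps_X * A * S * G" and H: "(1 - fps_X) * H2 = fps_X * B * S * H"
    using hyper_fps_ode[of a] hyper_fps_ode[of b]
    unfolding const A_def B_def G_def H_def G1_def H1_def G2_def H2_def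
    by (simp_all add: mult.assoc)
  have F: "hyper_prod a b = G * H"
    by (simp add: hyper_prod_def G_def H_def)
  have L: "hyper_conj a b = 2 * (A * G * H1 + B * G1 * H)"
    by (simp add: hyper_conj_def A_def B_def G_def H_def G1_def H1_def)
  have AB: "4 * A * B = 1"
  proof -
    have "4 * A * B = fps_const (fps_const (4 * a * b))"
      by (simp add: A_def B_def flip: fps_numeral_fps_const)
    then show ?thesis by (simp add: ab)
  qed
  have th2: "fps_theta (2 :: real fps fps) = 0"
    by (rule fps_ext) (simp add: fps_numeral_nth)
  have thA: "fps_theta A = 0" "fps_theta B = 0" by (simp_all add: A_def B_def)
  have theta: "fps_theta (fps_theta (hyper_prod a b)) = G2 * H + 2 * E + G * H2"
       "fps_theta E = G2 * H1 + G1 * H2"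
       "fps_theta (hyper_conj a b) = 2 * (A * (G1 * H1 + G * H2) + B * (G2 * H + G1 * H1))"
    unfolding F L E_def
    by (simp_all add: fps_theta_mult fps_theta_add th2 thA algebra_simps
          flip: G1_def H1_def G2_def H2_def)
  have "(1 - fps_X) * (fps_theta (fps_theta (hyper_prod a b)) - 2 * E) =
           fps_X * ((A + B) * S * hyper_prod a b)"
    unfolding theta unfolding F using G H by algebra
  from fps_nth_eq_partial_sum[OF this, of m]
  have 1: "of_nat (Suc m) * (of_nat (Suc m) * fps_nth (hyper_prod a b) (Suc m)) - 2 * fps_nth E (Suc m) = z * fps_X * P m"
    by (simp add: P_def z_def A_def B_def S_def sum_distrib_left flip: mult.assoc del: of_nat_Suc)
  have "(1 - fps_X) * (2 * fps_theta E) = fps_X * (S * hyper_conj a b)"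
    unfolding theta unfolding L E_def using G H by algebra
  from fps_nth_eq_partial_sum[OF this, of m]
  have 2: "2 * of_nat (Suc m) * fps_nth E (Suc m) = fps_X * Q m"
    by (simp add: Q_def S_def sum_distrib_left flip: mult.assoc del: of_nat_Suc)
  \<comment> \<open>The second derivatives contribute \<open>4 * A * B\<close> times the product;
    the normalisation of \<open>a * b\<close> makes this factor 1.\<close>
  have "(1 - fps_X) * (fps_theta (hyper_conj a b) - 2 * ((A + B) * E)) = fps_X * (S * hyper_prod a b)"
    unfolding theta unfolding F E_def using G H AB by algebra
  from fps_nth_eq_partial_sum[OF this, of m]
  have 3: "of_nat (Suc m) * fps_nth (hyper_conj a b) (Suc m) - 2 * (z * fps_nth E (Suc m)) = fps_X * P m"
    by (simp add: P_def z_def A_def B_def S_def sum_distrib_left del: of_nat_Suc)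
  have d: "d * of_nat (Suc m) = 1"
    unfolding d_def by (simp flip: fps_of_nat fps_const_1_eq_1 del: of_nat_Suc)
  have PS: "P (Suc m) = P m + fps_nth (hyper_prod a b) (Suc m)"
    "Q (Suc m) = Q m + fps_nth (hyper_conj a b) (Suc m)"
    by (simp_all add: P_def Q_def)
  show "P (Suc m) = (1 + z * fps_X * d ^ 2) * P m + fps_X * d ^ 3 * Q m"
    unfolding PS using 1 2 d by algebra
  show "Q (Suc m) = (1 + z * fps_X * d ^ 2) * Q m + fps_X * d * P m"
    unfolding PS using 3 2 d by algebra
qed

section \<open>Sine products\<close>

text \<open>The power of pi is graded by the exponent of s, so the property survives products and
  inverses of series.\<close>

definition pi_rational :: "(nat \<Rightarrow> real fps) \<Rightarrow> bool" where
  "pi_rational X \<longleftrightarrow> (\<forall>k. \<exists>q\<in>\<rat>. (\<lambda>M. fps_nth (X M) k) \<longlonglongrightarrow> q * pi ^ (2 * k))"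

lemma sum_convolution_power:
  fixes c :: "'a::comm_semiring_1"
  assumes "\<And>i. i \<in> A \<Longrightarrow> i \<le> k"
  shows "(\<Sum>i\<in>A. (x i * c ^ (2 * i)) * (y (k - i) * c ^ (2 * (k - i)))) = (\<Sum>i\<in>A. x i * y (k - i)) * c ^ (2 * k)"
  unfolding sum_distrib_right
proof (rule sum.cong)
  fix i assume "i \<in> A"
  then have k: "2 * k = 2 * i + 2 * (k - i)" using assms by fastforce
  have "c ^ (2 * k) = c ^ (2 * i) * c ^ (2 * (k - i))"
    by (subst k) (simp only: power_add)
  then show "(x i * c ^ (2 * i)) * (y (k - i) * c ^ (2 * (k - i))) = x i * y (k - i) * c ^ (2 * k)"
    by (simp add: ac_simps)
qed simp

lemma pi_rational_mult:
  assumes "pi_rational X" "pi_rational Y"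
  shows "pi_rational (\<lambda>M. X M * Y M)"
proof -
  obtain x y where x: "\<And>k. x k \<in> \<rat>" "\<And>k. (\<lambda>M. fps_nth (X M) k) \<longlonglongrightarrow> x k * pi ^ (2 * k)"
    and y: "\<And>k. y k \<in> \<rat>" "\<And>k. (\<lambda>M. fps_nth (Y M) k) \<longlonglongrightarrow> y k * pi ^ (2 * k)"
    using assms unfolding pi_rational_def by metis
  show ?thesis
    unfolding pi_rational_def
  proof (intro allI bexI)
    fix k
    show "(\<Sum>i=0..k. x i * y (k - i)) \<in> \<rat>" using x y by (intro Rats_sum Rats_mult)
    have "(\<lambda>M. fps_nth (X M * Y M) k) \<longlonglongrightarrow>
       (\<Sum>i=0..k. (x i * pi ^ (2 * i)) * (y (k - i) * pi ^ (2 * (k - i))))"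
      unfolding fps_mult_nth by (intro tendsto_intros x y)
    also have "(\<Sum>i=0..k. (x i * pi ^ (2 * i)) * (y (k - i) * pi ^ (2 * (k - i)))) =
       (\<Sum>i=0..k. x i * y (k - i)) * pi ^ (2 * k)"
      by (rule sum_convolution_power) auto
    finally show "(\<lambda>M. fps_nth (X M * Y M) k) \<longlonglongrightarrow> (\<Sum>i=0..k. x i * y (k - i)) * pi ^ (2 * k)" .
  qed
qed

text \<open>With constant term 1, each coefficient of the inverse is a finite convolution of earlier
  ones; the claim follows by strong induction.\<close>

lemma pi_rational_inverse:
  assumes X: "pi_rational X" and X0: "\<And>M. fps_nth (X M) 0 = 1"
  shows "pi_rational (\<lambda>M. inverse (X M))"
proof -
  obtain x where x: "\<And>k. x k \<in> \<rat>" "\<And>k. (\<lambda>M. fps_nth (X M) k) \<longlonglongrightarrow> x k * pi ^ (2 * k)"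
    using X unfolding pi_rational_def by metis
  have inv: "fps_nth (inverse (X M)) (Suc n) = - (\<Sum>i\<le>n. fps_nth (inverse (X M)) i * fps_nth (X M) (Suc n - i))"
    for M n
  proof -
    have "inverse (X M) * X M = 1" using X0[of M] by (intro inverse_mult_eq_1) simp
    then have "fps_nth (inverse (X M) * X M) (Suc n) = 0" by simp
    then show ?thesis using X0[of M] by (simp add: fps_mult_nth atLeast0AtMost)
  qed
  have "\<exists>q\<in>\<rat>. (\<lambda>M. fps_nth (inverse (X M)) k) \<longlonglongrightarrow> q * pi ^ (2 * k)" for k
  proof (induction k rule: less_induct)
    case (less k)
    show ?case
    proof (cases k)
      case 0
      then show ?thesis using X0 by (intro bexI[of _ 1]) auto
    next
      case (Suc n)
      obtain q where q: "\<And>i. i \<le> n \<Longrightarrow> q i \<in> \<rat>"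
        "\<And>i. i \<le> n \<Longrightarrow> (\<lambda>M. fps_nth (inverse (X M)) i) \<longlonglongrightarrow> q i * pi ^ (2 * i)"
        using less[unfolded Suc less_Suc_eq_le] by metis
      have "(\<lambda>M. fps_nth (inverse (X M)) (Suc n)) \<longlonglongrightarrow>
          - (\<Sum>i\<le>n. (q i * pi ^ (2 * i)) * (x (Suc n - i) * pi ^ (2 * (Suc n - i))))"
        unfolding inv by (intro tendsto_intros x q) auto
      also have "(\<Sum>i\<le>n. (q i * pi ^ (2 * i)) * (x (Suc n - i) * pi ^ (2 * (Suc n - i)))) =
          (\<Sum>i\<le>n. q i * x (Suc n - i)) * pi ^ (2 * Suc n)"
        by (rule sum_convolution_power) auto
      also have "- ((\<Sum>i\<le>n. q i * x (Suc n - i)) * pi ^ (2 * Suc n)) = (- (\<Sum>i\<le>n. q i * x (Suc n - i))) * pi ^ (2 * Suc n)"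
        by simp
      finally show ?thesis unfolding Suc using x q
        by (intro bexI[of _ "- (\<Sum>i\<le>n. q i * x (Suc n - i))"]) (auto intro!: Rats_sum Rats_mult)
    qed
  qed
  then show ?thesis by (simp add: pi_rational_def)
qed

text \<open>For a s = -x^2 this is the truncated Euler product of sin(pi x) / (pi x).\<close>

definition sine_prod :: "real \<Rightarrow> nat \<Rightarrow> real fps" where
  "sine_prod a M = (\<Prod>m=1..M. 1 + fps_const (a / real m ^ 2) * fps_X)"

lemma sine_prod_0 [simp]: "sine_prod a 0 = 1"
  by (simp add: sine_prod_def)

lemma sine_prod_Suc: "sine_prod a (Suc M) = (1 + fps_const (a / real (Suc M) ^ 2) * fps_X) * sine_prod a M"
  by (simp add: sine_prod_def mult.commute)

lemma sine_prod_nth_0 [simp]: "fps_nth (sine_prod a M) 0 = 1"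
  by (induction M) (simp_all add: sine_prod_Suc)

lemma sine_prod_nth_Suc:
  "fps_nth (sine_prod a (Suc M)) (Suc k) =
     fps_nth (sine_prod a M) (Suc k) + a / real (Suc M) ^ 2 * fps_nth (sine_prod a M) k"
  by (simp add: sine_prod_Suc distrib_right mult.assoc del: of_nat_Suc)

lemma sine_prod_nth_scale: "fps_nth (sine_prod a M) k = a ^ k * fps_nth (sine_prod 1 M) k"
proof (induction M arbitrary: k)
  case 0
  then show ?case by simp
next
  case (Suc M)
  then show ?case
    by (cases k) (simp_all add: sine_prod_nth_Suc Suc.IH[of k] Suc.IH[of "Suc _"] Suc.IH[of "k - 1"] algebra_simps del: of_nat_Suc)
qed

lemma sine_prod_nth_nonneg: "a \<ge> 0 \<Longrightarrow> fps_nth (sine_prod a M) k \<ge> 0"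
proof (induction M arbitrary: k)
  case (Suc M)
  then show ?case by (cases k) (simp_all add: sine_prod_nth_Suc)
qed simp

text \<open>An elementary symmetric function of the 1/m^2 is at most a power of their sum. The bound
  is uniform in \<open>M\<close> and serves as the dominating sequence below.\<close>

lemma sine_prod_nth_le: "fps_nth (sine_prod 1 M) k \<le> (pi ^ 2 / 6) ^ k"
proof -
  define H where "H M = (\<Sum>m<M. 1 / real (Suc m) ^ 2)" for M
  have H0: "H M \<ge> 0" for M by (auto simp: H_def intro!: sum_nonneg)
  have "fps_nth (sine_prod 1 M) k \<le> H M ^ k"
  proof (induction M arbitrary: k)
    case 0
    show ?case by (simp add: H_def)
  next
    case (Suc M)
    show ?case
    proof (cases k)
      case 0
      then show ?thesis by simp
    next
      case (Suc i)
      have "fps_nth (sine_prod 1 (Suc M)) k \<le> H M ^ Suc i + 1 / real (Suc M) ^ 2 * H M ^ i"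
        unfolding Suc sine_prod_nth_Suc by (intro add_mono mult_left_mono Suc.IH) auto
      also have "\<dots> = H (Suc M) * H M ^ i" by (simp add: H_def algebra_simps)
      also have "\<dots> \<le> H (Suc M) * H (Suc M) ^ i"
        by (intro mult_left_mono power_mono H0) (simp add: H_def)
      finally show ?thesis by (simp add: Suc)
    qed
  qed
  also have "H M \<le> pi ^ 2 / 6"
    using inverse_squares_sums sum_le_suminf[of "\<lambda>m. 1 / real (Suc m) ^ 2" "{..<M}"]
    by (simp add: H_def sums_iff)
  then have "H M ^ k \<le> (pi ^ 2 / 6) ^ k" by (intro power_mono H0)
  finally show ?thesis .
qed

lemma sine_prod_nth_sums:
  fixes x :: complex
  shows "(\<lambda>k. of_real (fps_nth (sine_prod 1 M) k) * x ^ k) sums (\<Prod>m=1..M. 1 + x / of_nat m ^ 2)"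
proof (induction M)
  case 0
  have "(\<lambda>k. of_real (fps_nth (sine_prod 1 0) k) * x ^ k) = (\<lambda>k. if k = 0 then 1 else 0)"
    by (auto simp: fun_eq_iff)
  then show ?case using sums_single[of 0 "\<lambda>_. 1 :: complex"] by simp
next
  case (Suc M)
  let ?S = "\<Prod>m=1..M. 1 + x / of_nat m ^ 2"
  have "(\<lambda>k. of_real (fps_nth (sine_prod 1 M) (Suc k)) * x ^ Suc k) sums (?S - 1)"
    using Suc by (subst sums_Suc_iff) simp
  then have "(\<lambda>k. of_real (fps_nth (sine_prod 1 M) (Suc k)) * x ^ Suc k +
       x / of_nat (Suc M) ^ 2 * (of_real (fps_nth (sine_prod 1 M) k) * x ^ k)) sums
       (?S - 1 + x / of_nat (Suc M) ^ 2 * ?S)"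
    by (intro sums_add sums_mult Suc)
  also have "(\<lambda>k. of_real (fps_nth (sine_prod 1 M) (Suc k)) * x ^ Suc k +
       x / of_nat (Suc M) ^ 2 * (of_real (fps_nth (sine_prod 1 M) k) * x ^ k)) =
       (\<lambda>k. of_real (fps_nth (sine_prod 1 (Suc M)) (Suc k)) * x ^ Suc k)"
    by (simp add: fun_eq_iff sine_prod_nth_Suc ring_distribs del: of_nat_Suc)
  finally show ?case
    by (subst (asm) sums_Suc_iff) (simp add: algebra_simps del: of_nat_Suc)
qed

lemma sinc_sums:
  fixes x :: complex
  assumes "x \<noteq> 0"
  shows "(\<lambda>k. (-1) ^ k * of_real (pi ^ (2 * k) / fact (2 * k + 1)) * (x ^ 2) ^ k) sums
           (sin (of_real pi * x) / (of_real pi * x))"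
proof -
  let ?y = "of_real pi * x"
  have "(\<lambda>n. sin_coeff (2 * n + 1) *\<^sub>R ?y ^ (2 * n + 1)) sums sin ?y"
    using sin_converges[of ?y]
    by (subst sums_mono_reindex[of "\<lambda>n. 2 * n + 1"])
       (auto simp: strict_mono_def sin_coeff_def elim!: oddE)
  then have "(\<lambda>n. sin_coeff (2 * n + 1) *\<^sub>R ?y ^ (2 * n + 1) / ?y) sums (sin ?y / ?y)"
    by (rule sums_divide)
  also have "(\<lambda>n. sin_coeff (2 * n + 1) *\<^sub>R ?y ^ (2 * n + 1) / ?y) =
     (\<lambda>k. (-1) ^ k * of_real (pi ^ (2 * k) / fact (2 * k + 1)) * (x ^ 2) ^ k)"
    using assms by (simp add: fun_eq_iff sin_coeff_def scaleR_conv_of_real power_mult power_mult_distrib)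
  finally show ?thesis .
qed

text \<open>Monotone bounded coefficients have limits \<open>e k\<close>. Their series agrees near 0
  with that of the sine quotient by Euler's product, so uniqueness of power series identifies
  them.\<close>

lemma sine_prod_nth_tendsto:
  "(\<lambda>M. fps_nth (sine_prod 1 M) k) \<longlonglongrightarrow> pi ^ (2 * k) / fact (2 * k + 1)"
proof -
  have "\<exists>e. (\<lambda>M. fps_nth (sine_prod 1 M) k) \<longlonglongrightarrow> e" for k
  proof -
    have "incseq (\<lambda>M. fps_nth (sine_prod 1 M) k)"
    proof (rule incseq_SucI)
      fix M
      show "fps_nth (sine_prod 1 M) k \<le> fps_nth (sine_prod 1 (Suc M)) k"
        by (cases k) (simp_all add: sine_prod_nth_Suc sine_prod_nth_nonneg)
    qed
    from incseq_convergent[OF this, of "(pi ^ 2 / 6) ^ k"] show ?thesis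
      using sine_prod_nth_le by blast
  qed
  then obtain e where e: "\<And>k. (\<lambda>M. fps_nth (sine_prod 1 M) k) \<longlonglongrightarrow> e k" by metis
  define C where "C = pi ^ 2 / 6"
  have C: "C > 0" by (simp add: C_def)
  define f g :: "complex fps" where "f = Abs_fps (\<lambda>k. (-1) ^ k * of_real (e k))"
    and "g = Abs_fps (\<lambda>k. (-1) ^ k * of_real (pi ^ (2 * k) / fact (2 * k + 1)))"
  \<comment> \<open>Tannery's theorem exchanges the limit in \<open>M\<close> with the sum over
    \<open>k\<close>, dominated by a geometric series.\<close>
  have main: "summable (\<lambda>k. norm (fps_nth f k * (x ^ 2) ^ k)) \<and>
         (\<lambda>M. \<Prod>m=1..M. 1 - x ^ 2 / of_nat m ^ 2) \<longlonglongrightarrow> eval_fps f (x ^ 2)"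
    if x: "C * norm (x ^ 2) < 1" for x
  proof -
    let ?a = "\<lambda>k M. of_real (fps_nth (sine_prod 1 M) k) * (- (x ^ 2)) ^ k"
    have f: "(\<lambda>k. fps_nth f k * (x ^ 2) ^ k) = (\<lambda>k. of_real (e k) * (- (x ^ 2)) ^ k)"
      by (simp add: fun_eq_iff f_def power_minus[of "x ^ 2"])
    have "case p of (k, M) \<Rightarrow> norm (?a k M) \<le> (C * norm (x ^ 2)) ^ k" for p
    proof (cases p)
      case (Pair k M)
      show ?thesis
        unfolding Pair case_prod_conv norm_mult norm_power norm_minus_cancel norm_of_real power_mult_distrib C_def
        using sine_prod_nth_le[of M k] by (intro mult_right_mono) (simp_all add: sine_prod_nth_nonneg)
    qed
    then have bound: "\<forall>\<^sub>F (k, M) in sequentially \<times>\<^sub>F sequentially. norm (?a k M) \<le> (C * norm (x ^ 2)) ^ k"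
      by (intro always_eventually allI)
    have "summable (\<lambda>k. norm (of_real (e k) * (- (x ^ 2)) ^ k)) \<and>
      ((\<lambda>M. suminf (\<lambda>k. ?a k M)) \<longlonglongrightarrow> suminf (\<lambda>k. of_real (e k) * (- (x ^ 2)) ^ k))"
      using x C
      by (intro conjunct2[OF tannerys_theorem[OF _ bound]])
         (auto intro!: tendsto_mult tendsto_of_real tendsto_const e summable_geometric)
    moreover have "suminf (\<lambda>k. ?a k M) = (\<Prod>m=1..M. 1 - x ^ 2 / of_nat m ^ 2)" for M
      using sine_prod_nth_sums[of M "- (x ^ 2)"] by (simp add: sums_iff)
    moreover have "eval_fps f (x ^ 2) = suminf (\<lambda>k. of_real (e k) * (- (x ^ 2)) ^ k)"
      unfolding eval_fps_def by (simp only: f)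
    moreover have "(\<lambda>k. norm (fps_nth f k * (x ^ 2) ^ k)) = (\<lambda>k. norm (of_real (e k) * (- (x ^ 2)) ^ k))"
      by (rule ext, rule arg_cong[where f = norm]) (rule fun_cong[OF f])
    ultimately show ?thesis by simp
  qed
  have eq: "eval_fps f w = eval_fps g w" if w: "C * norm w < 1" for w
  proof (cases "w = 0")
    \<comment> \<open>The sine quotient is 0/0 here, so constant terms are compared instead.\<close>
    case True
    have "e 0 = 1" using LIMSEQ_unique[OF e[of 0]] by simp
    then show ?thesis using True by (simp add: eval_fps_at_0 f_def g_def)
  next
    case False
    define x where "x = csqrt w"
    have x: "x ^ 2 = w" "x \<noteq> 0" using False by (auto simp: x_def)
    have "(\<lambda>M. \<Prod>m=1..M. 1 - x ^ 2 / of_nat m ^ 2) \<longlonglongrightarrow> sin (of_real pi * x) / (of_real pi * x)"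
      using tendsto_divide[OF sin_product_formula_complex[of x] tendsto_const[of "of_real pi * x"]] x(2)
      by simp
    moreover have "sin (of_real pi * x) / (of_real pi * x) = eval_fps g w"
      using sinc_sums[OF x(2)] by (simp add: sums_iff eval_fps_def g_def x(1))
    ultimately show ?thesis using main[of x] w x LIMSEQ_unique by auto
  qed
  \<comment> \<open>Half the radius of the disc on which the geometric bound converges.\<close>
  define r where "r = 1 / (2 * C)"
  have r: "r > 0" "C * r < 1" using C by (simp_all add: r_def)
  define x where "x = complex_of_real (sqrt r)"
  have x: "x ^ 2 = of_real r" "x \<noteq> 0" "norm (x ^ 2) = r"
    using r by (simp_all add: x_def flip: of_real_power)
  have "f = g"
  proof (rule eval_fps_eqD)
    have "summable (\<lambda>k. fps_nth f k * (x ^ 2) ^ k)"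
      using main[of x] r x by (intro summable_norm_cancel[where f = "\<lambda>k. fps_nth f k * (x ^ 2) ^ k"]) auto
    then have "fps_conv_radius f \<ge> norm (x ^ 2)"
      unfolding fps_conv_radius_def by (rule conv_radius_geI)
    then show "fps_conv_radius f > 0" using r x by (metis ereal_less(2) less_le_trans)
    have "summable (\<lambda>k. fps_nth g k * (x ^ 2) ^ k)"
      using sinc_sums[OF x(2)] by (simp add: sums_iff g_def)
    then have "fps_conv_radius g \<ge> norm (x ^ 2)"
      unfolding fps_conv_radius_def by (rule conv_radius_geI)
    then show "fps_conv_radius g > 0" using r x by (metis ereal_less(2) less_le_trans)
    show "\<forall>\<^sub>F z in nhds 0. eval_fps f z = eval_fps g z"
      unfolding eventually_nhds_metric
    proof (intro exI[of _ r] conjI allI impI r)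
      fix z :: complex assume "dist z 0 < r"
      then have "C * norm z < C * r" using C by simp
      then show "eval_fps f z = eval_fps g z" using eq r by auto
    qed
  qed
  then have "fps_nth f k = fps_nth g k" by simp
  then have "complex_of_real (e k) = of_real (pi ^ (2 * k) / fact (2 * k + 1))"
    unfolding f_def g_def fps_nth_Abs_fps mult_cancel_left by simp
  then have "e k = pi ^ (2 * k) / fact (2 * k + 1)" by (simp only: of_real_eq_iff)
  then show ?thesis using e[of k] by simp
qed

lemma pi_rational_sine_prod:
  assumes "a \<in> \<rat>"
  shows "pi_rational (sine_prod a)"
  unfolding pi_rational_def
proof (intro allI bexI)
  fix k
  show "a ^ k / fact (2 * k + 1) \<in> \<rat>"
    using assms Rats_of_nat[of "fact (2 * k + 1)"] unfolding of_nat_fact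
    by (intro Rats_divide Rats_power)
  have "(\<lambda>M. a ^ k * fps_nth (sine_prod 1 M) k) \<longlonglongrightarrow> a ^ k * (pi ^ (2 * k) / fact (2 * k + 1))"
    by (intro tendsto_intros sine_prod_nth_tendsto)
  then show "(\<lambda>M. fps_nth (sine_prod a M) k) \<longlonglongrightarrow> a ^ k / fact (2 * k + 1) * pi ^ (2 * k)"
    unfolding sine_prod_nth_scale[of a] times_divide_eq_left times_divide_eq_right .
qed

section \<open>The generating series\<close>

text \<open>Moving the factors k^2 one index down gives the difference of consecutive sine products,
  so the partial sums at t = 1 telescope to \<open>sine_prod\<close>.\<close>

lemma hyper_coeff_Suc_eq:
  "hyper_coeff a (Suc M) = fps_const (a / real (Suc M) ^ 2) * fps_X * sine_prod a M"
proof (induction M)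
  case 0
  show ?case by simp
next
  case (Suc M)
  define u v w where "u = fps_const (1 / real (Suc (Suc M)) ^ 2)" and "v = fps_const (real (Suc M) ^ 2)"
    and "w = fps_const (1 / real (Suc M) ^ 2)"
  have vw: "v * w = 1" by (simp add: v_def w_def del: of_nat_Suc)
  have const: "fps_const (a / real (Suc M) ^ 2) = fps_const a * w"
    "fps_const (a / real (Suc (Suc M)) ^ 2) = fps_const a * u"
    by (simp_all add: u_def w_def del: of_nat_Suc)
  have "hyper_coeff a (Suc (Suc M)) = u * (v + fps_const a * fps_X) * (fps_const a * w * fps_X * sine_prod a M)"
    unfolding hyper_coeff.simps(2)[of a "Suc M"] Suc.IH by (simp only: const u_def v_def)
  also have "\<dots> = fps_const a * u * fps_X * ((1 + fps_const a * w * fps_X) * sine_prod a M)"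
    using vw by algebra
  finally show ?case by (simp only: sine_prod_Suc const)
qed

lemma sum_hyper_coeff: "(\<Sum>k\<le>M. hyper_coeff a k) = sine_prod a M"
proof (induction M)
  case (Suc M)
  then show ?case
    by (simp add: hyper_coeff_Suc_eq sine_prod_Suc algebra_simps del: hyper_coeff.simps(2) of_nat_Suc)
qed simp

lemma hyper_coeff_nth_nonneg: "a \<ge> 0 \<Longrightarrow> fps_nth (hyper_coeff a k) n \<ge> 0"
proof (cases k)
  case (Suc M)
  assume "a \<ge> 0"
  then show ?thesis
    unfolding Suc hyper_coeff_Suc_eq by (simp add: mult.assoc sine_prod_nth_nonneg del: of_nat_Suc)
qed simp

text \<open>
  The partial sums of the Cauchy product run over a triangle that lies between two squares, and all
  terms are nonnegative.
\<close>

lemma hyper_prod_box_le: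
  fixes a b :: real
  assumes "a \<ge> 0" "b \<ge> 0"
  shows "fps_nth (sine_prod a (M div 2) * sine_prod b (M div 2)) n \<le> fps_nth (\<Sum>i\<le>M. fps_nth (hyper_prod a b) i) n" (is ?lower)
    and "fps_nth (\<Sum>i\<le>M. fps_nth (hyper_prod a b) i) n \<le> fps_nth (sine_prod a M * sine_prod b M) n" (is ?upper)
proof -
  let ?f = "\<lambda>(i, j). fps_nth (hyper_coeff a i * hyper_coeff b j) n"
  have nonneg: "?f p \<ge> 0" for p
    using assms by (auto simp: fps_mult_nth intro!: sum_nonneg mult_nonneg_nonneg hyper_coeff_nth_nonneg split: prod.split)
  have "(\<Sum>i\<le>M. fps_nth (hyper_prod a b) i) = (\<Sum>m\<le>M. \<Sum>i\<le>m. hyper_coeff a i * hyper_coeff b (m - i))"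
    by (simp add: hyper_prod_def fps_mult_nth atLeast0AtMost)
  also have "\<dots> = (\<Sum>(i, j)\<in>{(i, j). i + j \<le> M}. hyper_coeff a i * hyper_coeff b j)"
    by (rule sum.triangle_reindex_eq[symmetric])
  finally have tri: "fps_nth (\<Sum>i\<le>M. fps_nth (hyper_prod a b) i) n = sum ?f {(i, j). i + j \<le> M}"
    by (simp add: fps_sum_nth case_prod_unfold)
  have box: "fps_nth (sine_prod a K * sine_prod b K) n = sum ?f ({..K} \<times> {..K})" for K
    by (simp add: sum_product sum.cartesian_product fps_sum_nth case_prod_unfold flip: sum_hyper_coeff)
  have fin: "finite {(i, j). i + j \<le> M}"
    by (rule finite_subset[of _ "{..M} \<times> {..M}"]) auto
  show ?lower unfolding tri box using nonneg fin by (intro sum_mono2) auto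
  show ?upper unfolding tri box using nonneg by (intro sum_mono2) auto
qed

text \<open>The squares of sides \<open>M div 2\<close> and \<open>M\<close> enclose the triangle
  and have the same limit, a product of two sine products.\<close>

lemma pi_rational_hyper_prod:
  assumes "a \<in> \<rat>" "b \<in> \<rat>" "a \<ge> 0" "b \<ge> 0"
  shows "pi_rational (\<lambda>M. \<Sum>i\<le>M. fps_nth (hyper_prod a b) i)"
  unfolding pi_rational_def
proof
  fix n
  have "pi_rational (\<lambda>M. sine_prod a M * sine_prod b M)"
    using assms by (intro pi_rational_mult pi_rational_sine_prod)
  then obtain q where q: "q \<in> \<rat>" "(\<lambda>M. fps_nth (sine_prod a M * sine_prod b M) n) \<longlonglongrightarrow> q * pi ^ (2 * n)"
    unfolding pi_rational_def by blast
  have "filterlim (\<lambda>M::nat. M div 2) at_top at_top"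
    unfolding filterlim_at_top eventually_sequentially
    by (metis div_le_mono nonzero_mult_div_cancel_left zero_neq_numeral)
  note lower = filterlim_compose[OF q(2) this]
  have "(\<lambda>M. fps_nth (\<Sum>i\<le>M. fps_nth (hyper_prod a b) i) n) \<longlonglongrightarrow> q * pi ^ (2 * n)"
    by (rule tendsto_sandwich[OF _ _ lower q(2)])
       (intro always_eventually allI hyper_prod_box_le assms(3,4))+
  then show "\<exists>q\<in>\<rat>. (\<lambda>M. fps_nth (\<Sum>i\<le>M. fps_nth (hyper_prod a b) i) n) \<longlonglongrightarrow> q * pi ^ (2 * n)"
    using q(1) by blast
qed

section \<open>Zeta-star sums collected by number of letters\<close>

text \<open>
  The flag tells whether the next odd letter is a 3, i.e. whether an even number of them remains.
\<close>

definition star_fps :: "bool \<Rightarrow> real \<Rightarrow> nat \<Rightarrow> real fps" where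
  "star_fps e z M = Abs_fps (\<lambda>N. \<Sum>j\<le>N. if even (N - j) = e then star_sum (N - j) j M * (- z) ^ j else 0)"

lemma star_fps_0: "star_fps e z 0 = (if e then 1 else 0)"
proof (rule fps_ext)
  fix N
  have "fps_nth (star_fps e z 0) N = (\<Sum>j\<le>N. if j = 0 then (if N = 0 \<and> e then 1 else 0) else 0)"
    unfolding star_fps_def fps_nth_Abs_fps by (intro sum.cong) (auto simp: star_sum_0)
  then show "fps_nth (star_fps e z 0) N = fps_nth (if e then 1 else 0) N"
    by auto
qed

text \<open>Removing a 2 lowers \<open>j\<close> and costs a factor \<open>- z\<close>; removing an
  odd letter keeps \<open>j\<close> and flips the flag.\<close>

lemma star_fps_nth_Suc:
  "fps_nth (star_fps e z (Suc M)) (Suc N) = fps_nth (star_fps e z M) (Suc N)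
     - z / real (Suc M) ^ 2 * fps_nth (star_fps e z (Suc M)) N
     + 1 / real (Suc M) ^ (if e then 3 else 1) * fps_nth (star_fps (\<not> e) z (Suc M)) N"
proof -
  let ?t = "\<lambda>j. star_sum (Suc N - j) (j - 1) (Suc M) / real (Suc M) ^ 2"
  let ?o = "\<lambda>j. star_sum (Suc N - j - 1) j (Suc M) / real (Suc M) ^ (if even (Suc N - j) then 3 else 1)"
  have "fps_nth (star_fps e z (Suc M)) (Suc N) - fps_nth (star_fps e z M) (Suc N) =
     (\<Sum>j\<le>Suc N. if even (Suc N - j) = e then (if j = 0 then 0 else ?t j) * (- z) ^ j else 0) +
     (\<Sum>j\<le>Suc N. if even (Suc N - j) = e then (if Suc N - j = 0 then 0 else ?o j) * (- z) ^ j else 0)"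
    unfolding star_fps_def fps_nth_Abs_fps sum_subtractf[symmetric] sum.distrib[symmetric]
  proof (intro sum.cong refl)
    fix j
    have split: "(if b then x * y else 0) - (if b then x' * y else 0) =
        (if b then u * y else 0) + (if b then v * y else 0)"
      if "x = x' + u + v" for b and x x' y u v :: real
      using that by (simp add: algebra_simps)
    show "(if even (Suc N - j) = e then star_sum (Suc N - j) j (Suc M) * (- z) ^ j else 0) -
        (if even (Suc N - j) = e then star_sum (Suc N - j) j M * (- z) ^ j else 0) =
        (if even (Suc N - j) = e then (if j = 0 then 0 else ?t j) * (- z) ^ j else 0) +
        (if even (Suc N - j) = e then (if Suc N - j = 0 then 0 else ?o j) * (- z) ^ j else 0)"
      by (rule split, rule star_sum_Suc)
  qed
  \<comment> \<open>The term \<open>j = 0\<close> vanishes, so the index shifts by one.\<close>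
  also have "(\<Sum>j\<le>Suc N. if even (Suc N - j) = e then (if j = 0 then 0 else ?t j) * (- z) ^ j else 0) =
     - z / real (Suc M) ^ 2 * fps_nth (star_fps e z (Suc M)) N"
    unfolding star_fps_def fps_nth_Abs_fps sum_distrib_left sum.atMost_Suc_shift
      simp_thms if_True mult_zero_left if_cancel add_0_left diff_Suc_Suc diff_Suc_1 nat.distinct if_False
    by (intro sum.cong refl) (simp del: of_nat_Suc)
  \<comment> \<open>The term \<open>j = Suc N\<close> vanishes, since no odd letter is left.\<close>
  also have "(\<Sum>j\<le>Suc N. if even (Suc N - j) = e then (if Suc N - j = 0 then 0 else ?o j) * (- z) ^ j else 0) =
     1 / real (Suc M) ^ (if e then 3 else 1) * fps_nth (star_fps (\<not> e) z (Suc M)) N"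
    unfolding star_fps_def fps_nth_Abs_fps sum_distrib_left sum.atMost_Suc
      diff_self_eq_0 simp_thms if_True mult_zero_left if_cancel add_0_right
    by (intro sum.cong refl) (cases e; simp add: Suc_diff_le del: of_nat_Suc)
  finally show ?thesis by simp
qed

lemma star_fps_nth_0: "fps_nth (star_fps e z M) 0 = (if e then 1 else 0)"
proof -
  have "star_sum 0 0 M = 1" by (induction M) (simp_all add: star_sum_0 star_sum_Suc)
  then show ?thesis by (simp add: star_fps_def)
qed

text \<open>In matrix form, I - s N(-z) maps the pair of series at \<open>Suc M\<close> to the pair
  at \<open>M\<close>.\<close>

lemma star_fps_Suc:
  fixes M :: nat
  defines "d \<equiv> fps_const (1 / real (Suc M))"
  shows "star_fps e z (Suc M) = star_fps e z M - fps_const z * d ^ 2 * fps_X * star_fps e z (Suc M)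
     + d ^ (if e then 3 else 1) * fps_X * star_fps (\<not> e) z (Suc M)"
proof (rule fps_ext)
  fix N
  show "fps_nth (star_fps e z (Suc M)) N = fps_nth (star_fps e z M - fps_const z * d ^ 2 * fps_X * star_fps e z (Suc M)
     + d ^ (if e then 3 else 1) * fps_X * star_fps (\<not> e) z (Suc M)) N"
    by (cases N)
       (simp_all add: star_fps_nth_0 star_fps_nth_Suc d_def mult.assoc fps_const_power power_one_over
          del: of_nat_Suc)
qed

text \<open>The adjugate of I - s N(-z) is I + s N(z). Clearing determinants therefore leaves the
  recursion of \<open>hyper_prod_rec\<close>, with the same initial values 1 and 0.\<close>

lemma star_fps_eq_hyper_prod:
  fixes a b :: real
  assumes ab: "4 * a * b = 1"
  defines "z \<equiv> a + b"
  shows "sine_prod (z + 1) M * sine_prod (z - 1) M * star_fps True z M = (\<Sum>i\<le>M. fps_nth (hyper_prod a b) i)"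
    and "sine_prod (z + 1) M * sine_prod (z - 1) M * star_fps False z M = (\<Sum>i\<le>M. fps_nth (hyper_conj a b) i)"
proof (induction M)
  case 0
  {
    case 1
    show ?case by (simp add: star_fps_0 hyper_prod_def)
  next
    case 2
    show ?case by (simp add: star_fps_0 hyper_conj_def)
  }
next
  case (Suc M)
  define d where "d = fps_const (1 / real (Suc M))"
  define D D' where "D = sine_prod (z + 1) M * sine_prod (z - 1) M"
    and "D' = sine_prod (z + 1) (Suc M) * sine_prod (z - 1) (Suc M)"
  define A B where "A = star_fps True z M" and "B = star_fps False z M"
  define A' B' where "A' = star_fps True z (Suc M)" and "B' = star_fps False z (Suc M)"
  have const: "fps_const (x / real (Suc M) ^ 2) = fps_const x * d ^ 2" for x
    by (simp add: d_def fps_const_power power_one_over del: of_nat_Suc)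
  have "fps_const (z + 1) = fps_const z + 1" "fps_const (z - 1) = fps_const z - 1"
    by (simp_all flip: fps_const_1_eq_1)
  \<comment> \<open>The bracket is the determinant of I - s N(-z).\<close>
  then have D': "D' = ((1 + fps_const z * fps_X * d ^ 2) ^ 2 - fps_X ^ 2 * d ^ 4) * D"
    unfolding D'_def D_def sine_prod_Suc const by algebra
  have A': "A' = A - fps_const z * d ^ 2 * fps_X * A' + d ^ 3 * fps_X * B'"
    and B': "B' = B - fps_const z * d ^ 2 * fps_X * B' + d * fps_X * A'"
    using star_fps_Suc[of True z M] star_fps_Suc[of False z M]
    by (simp_all add: A'_def B'_def A_def B_def d_def)
  have IH: "D * A = (\<Sum>i\<le>M. fps_nth (hyper_prod a b) i)" "D * B = (\<Sum>i\<le>M. fps_nth (hyper_conj a b) i)"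
    using Suc by (simp_all add: D_def A_def B_def)
  {
    case 1
    have "D' * A' = (1 + fps_const z * fps_X * d ^ 2) * (D * A) + fps_X * d ^ 3 * (D * B)"
      using D' A' B' by algebra
    then show ?case
      unfolding IH using hyper_prod_rec(1)[OF ab, of M]
      by (simp only: D'_def A'_def d_def z_def)
  next
    case 2
    have "D' * B' = (1 + fps_const z * fps_X * d ^ 2) * (D * B) + fps_X * d * (D * A)"
      using D' A' B' by algebra
    then show ?case
      unfolding IH using hyper_prod_rec(2)[OF ab, of M]
      by (simp only: D'_def B'_def d_def z_def)
  }
qed

lemma pi_rational_star_fps:
  assumes "a \<in> \<rat>" "b \<in> \<rat>" "a \<ge> 0" "b \<ge> 0" "4 * a * b = 1"
  shows "pi_rational (star_fps True (a + b))"
proof -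
  let ?D = "\<lambda>M. sine_prod (a + b + 1) M * sine_prod (a + b - 1) M"
  have D: "pi_rational ?D"
    using assms by (intro pi_rational_mult pi_rational_sine_prod) auto
  have "pi_rational (\<lambda>M. inverse (?D M) * (\<Sum>i\<le>M. fps_nth (hyper_prod a b) i))"
    using assms by (intro pi_rational_mult[OF pi_rational_inverse[OF D]] pi_rational_hyper_prod) auto
  moreover have "inverse (?D M) * (\<Sum>i\<le>M. fps_nth (hyper_prod a b) i) = star_fps True (a + b) M" for M
  proof -
    have "inverse (?D M) * ?D M = 1" by (intro inverse_mult_eq_1) simp
    then show ?thesis
      by (simp only: star_fps_eq_hyper_prod(1)[OF assms(5), symmetric] mult.assoc[symmetric]) simp
  qed
  ultimately show ?thesis by (simp only: eta_contract_eq)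
qed

section \<open>Convergence, and rationality of single coefficients\<close>

lemma star_sum_bounded:
  assumes "even r"
  obtains C where "\<And>M. star_sum r j M \<le> C"
proof -
  define N where "N = r + j"
  \<comment> \<open>The admissible pair a = 1, b = 1/4.\<close>
  define z :: real where "z = 1 + 1 / 4"
  have "pi_rational (star_fps True z)" unfolding z_def by (rule pi_rational_star_fps) auto
  then have "convergent (\<lambda>M. fps_nth (star_fps True z M) N)"
    by (auto simp: pi_rational_def convergent_def)
  then obtain K where K: "\<And>M. \<bar>fps_nth (star_fps True z M) N\<bar> \<le> K"
    by (metis BseqE convergent_imp_Bseq real_norm_def)
  have "star_sum r j M \<le> K / z ^ j" for M
  proof -
    let ?f = "\<lambda>i. if even (N - i) then star_sum (N - i) i M * z ^ i else 0"
    have nonneg: "star_sum r j M \<ge> 0" for r j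
      by (simp add: star_sum_def sum_nonneg)
    \<comment> \<open>All contributing \<open>i\<close> have the parity of \<open>N\<close>, so the
      terms share one sign and none can cancel; a bound on the whole coefficient bounds each
      term.\<close>
    have sgn: "star_sum (N - i) i M * (- z) ^ i = (-1) ^ N * (star_sum (N - i) i M * z ^ i)"
      if "i \<le> N" "even (N - i)" for i
      using that by (cases "even i") auto
    have "fps_nth (star_fps True z M) N = (-1) ^ N * (\<Sum>i\<le>N. ?f i)"
      unfolding star_fps_def fps_nth_Abs_fps sum_distrib_left
      by (intro sum.cong) (auto simp: sgn)
    moreover have "(\<Sum>i\<le>N. ?f i) \<ge> ?f j"
      by (rule member_le_sum) (auto simp: N_def z_def nonneg)
    ultimately have "?f j \<le> K" using K[of M] by (simp add: abs_mult power_abs)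
    then show ?thesis using assms by (simp add: N_def z_def field_simps)
  qed
  then show thesis by (rule that)
qed

lemma star_sum_tendsto:
  assumes "even r"
  shows "star_sum r j \<longlonglongrightarrow> (\<Sum>js\<in>compositions r j. zeta_star (insert_twos js))"
proof -
  obtain C where C: "\<And>M. star_sum r j M \<le> C" using star_sum_bounded[OF assms, of j] by blast
  have "(\<lambda>M. zeta_star_upto M (insert_twos js)) \<longlonglongrightarrow> zeta_star (insert_twos js)"
    if js: "js \<in> compositions r j" for js
  proof (rule zeta_star_upto_tendsto)
    fix M
    have "zeta_star_upto M (insert_twos js) \<le> star_sum r j M"
      unfolding star_sum_def by (rule member_le_sum[OF js]) auto
    then show "zeta_star_upto M (insert_twos js) \<le> C" using C[of M] by linarith
  qed
  then show ?thesis unfolding star_sum_def by (intro tendsto_sum)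
qed

text \<open>Induction on the degree: after division by X - x with x in \<open>S\<close>, the
  quotient is again rational-valued on the infinite set \<open>S - {x}\<close>.\<close>

lemma coeff_in_Rats:
  fixes p :: "real poly"
  assumes "infinite S" "S \<subseteq> \<rat>" "\<And>x. x \<in> S \<Longrightarrow> poly p x \<in> \<rat>"
  shows "coeff p i \<in> \<rat>"
  using assms
proof (induction "degree p" arbitrary: p S i)
  case 0
  then obtain c where p: "p = [:c:]" using degree_eq_zeroE by metis
  obtain x where "x \<in> S" using 0 by (metis finite.emptyI ex_in_conv)
  then have "c \<in> \<rat>" using 0 p by auto
  then show ?case using p by (cases i) auto
next
  case (Suc n)
  obtain x where x: "x \<in> S" using Suc by (metis finite.emptyI ex_in_conv)
  have rats: "y \<in> \<rat>" "poly p y \<in> \<rat>" if "y \<in> S" for y using that Suc.prems by auto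
  define r where "r = synthetic_div p x"
  have p: "p = [:- x, 1:] * r + [:poly p x:]"
    unfolding r_def by (rule synthetic_div_correct'[symmetric])
  have "coeff r k \<in> \<rat>" for k
  proof (rule Suc.hyps(1)[of r "S - {x}"])
    show "n = degree r" using Suc.hyps(2) by (simp add: r_def degree_synthetic_div)
    fix y assume y: "y \<in> S - {x}"
    have "poly p y = (y - x) * poly r y + poly p x" using arg_cong[OF p, of "\<lambda>q. poly q y"]
      by (simp add: algebra_simps)
    then have "poly r y = (poly p y - poly p x) / (y - x)" using y by (simp add: field_simps)
    then show "poly r y \<in> \<rat>" using y x by (simp add: rats)
  qed (use Suc.prems in auto)
  moreover have "coeff p i = - x * coeff r i + (case i of 0 \<Rightarrow> poly p x | Suc k \<Rightarrow> coeff r k)"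
    by (subst p) (simp add: coeff_pCons split: nat.split)
  ultimately show ?case using x by (simp add: rats split: nat.split)
qed

theorem theorem1p1:
  fixes n :: nat
  shows "\<exists>q\<in>\<rat>. (\<Sum>js\<in>{js :: nat list. length js = 2 * n + 1 \<and> sum_list js = 2}.
            zeta_star (inserted_index n js)) = q * pi ^ (4 * n + 4)"
proof -
  \<comment> \<open>The number of letters: 2n odd ones and two twos.\<close>
  define N where "N = 2 * n + 2"
  define V where "V r j = (\<Sum>js\<in>compositions r j. zeta_star (insert_twos js))" for r j
  define c where "c j = (if even (N - j) then V (N - j) j else 0) / pi ^ (2 * N)" for j
  define p where "p = (\<Sum>j\<le>N. monom (c j) j)"
  \<comment> \<open>The value of -(a + b) for a = k and b = 1/(4k), which satisfy 4ab = 1.\<close>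
  define f where "f k = - (real k + 1 / (4 * real k))" for k :: nat
  have "poly p (f k) \<in> \<rat>" if k: "k \<ge> 1" for k
  proof -
    have "pi_rational (star_fps True (- f k))"
      unfolding f_def minus_minus using k by (intro pi_rational_star_fps) auto
    then obtain q where q: "q \<in> \<rat>" "(\<lambda>M. fps_nth (star_fps True (- f k) M) N) \<longlonglongrightarrow> q * pi ^ (2 * N)"
      unfolding pi_rational_def by blast
    have "(\<lambda>M. fps_nth (star_fps True (- f k) M) N) \<longlonglongrightarrow>
        (\<Sum>j\<le>N. if even (N - j) then V (N - j) j * f k ^ j else 0)"
      unfolding star_fps_def fps_nth_Abs_fps V_def minus_minus
      by (intro tendsto_sum) (auto intro!: tendsto_mult star_sum_tendsto)
    from LIMSEQ_unique[OF q(2) this]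
    have "q * pi ^ (2 * N) = (\<Sum>j\<le>N. if even (N - j) then V (N - j) j * f k ^ j else 0)" .
    also have "\<dots> = poly p (f k) * pi ^ (2 * N)"
      unfolding p_def poly_sum poly_monom sum_distrib_right by (intro sum.cong) (auto simp: c_def)
    finally show ?thesis using q(1) by simp
  qed
  moreover have "f ` {1..} \<subseteq> \<rat>" by (auto simp: f_def)
  moreover have "infinite (f ` {1..})"
  proof -
    \<comment> \<open>As 1/(4k) lies strictly between 0 and 1, the floor of \<open>- f k\<close>
      recovers \<open>k\<close>.\<close>
    have "inj_on f {1..}"
    proof (rule inj_on_inverseI)
      fix k :: nat assume "k \<in> {1..}"
      then have "0 < 1 / (4 * real k)" "1 / (4 * real k) < 1" by (auto simp: field_simps)
      then have "\<lfloor>- f k\<rfloor> = int k" by (simp add: f_def floor_eq_iff)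
      then show "nat \<lfloor>- f k\<rfloor> = k" by simp
    qed
    then show ?thesis by (simp add: finite_image_iff infinite_Ici)
  qed
  ultimately have "coeff p 2 \<in> \<rat>" using coeff_in_Rats[of "f ` {1..}" p 2] by blast
  moreover have "coeff p 2 = V (2 * n) 2 / pi ^ (2 * N)"
  proof -
    have "2 \<le> N" by (simp add: N_def)
    then have "coeff p 2 = c 2" by (simp add: p_def coeff_sum)
    also have "N - 2 = 2 * n" by (simp add: N_def)
    then have "c 2 = V (2 * n) 2 / pi ^ (2 * N)" by (simp add: c_def)
    finally show ?thesis .
  qed
  moreover have "(\<Sum>js\<in>{js :: nat list. length js = 2 * n + 1 \<and> sum_list js = 2}.
      zeta_star (inserted_index n js)) = V (2 * n) 2"
    unfolding V_def compositions_def by (intro sum.cong refl) (simp add: inserted_index_eq)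
  moreover have "2 * N = 4 * n + 4" by (simp add: N_def)
  ultimately show ?thesis by (intro bexI[of _ "coeff p 2"]) simp_all
qed

end
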